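(* Let $m,n,k$ be positive integers and let $F$ be a field whose characteristic does not divide $k$. If $M$ is a non-zero $m^k\times n^k$ matrix over $F$ and $A$ is an $m\times n$ matrix over $F$ such that $M=\bigotimes^k A$, then $R_{m\times n}^{\Sigma}(M)$ has rank one.
   Context: All matrices have entries in the field $F$ (a field of characteristic $0$ counts as having characteristic not dividing $k$). $\otimes$ denotes the Kronecker product of matrices, and $\bigotimes^k A = A\otimes\cdots\otimes A$ ($k$ factors) is the $k$-th Kronecker power of $A$. $\mathrm{vec}(A)$ denotes the column vector obtained by stacking the columns of the matrix $A$ on top of one another. For $j\in\{1,\ldots,k\}$, the $j$-th rearrangement operator $R_{m\times n}^{(j)}$ is the linear map from $m^k\times n^k$ matrices to $mn\times (mn)^{k-1}$ matrices defined on Kronecker products of $m\times n$ matrices $A_1,\ldots,A_k$ by $$R_{m\times n}^{(j)}(A_1\otimes\cdots\otimes A_k)=\mathrm{vec}(A_j)\,\mathrm{vec}(A_1\otimes\cdots\otimes A_{j-1}\otimes A_{j+1}\otimes\cdots\otimes A_k)^T$$ and extended linearly (an empty Kronecker product is the $1\times 1$ matrix $(1)$). The operator $R_{m\times n}^{\Sigma}$ is the linear map on $m^k\times n^k$ matrices defined by $$R_{m\times n}^{\Sigma}(A_1\otimes\cdots\otimes A_k)=\sum_{j=1}^k R_{m\times n}^{(j)}(A_1\otimes\cdots\otimes A_k)$$ for $m\times n$ matrices $A_1,\ldots,A_k$, and linear extension. *)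

theory Defs
  imports "Jordan_Normal_Form.DL_Rank" "HOL-Library.FuncSet"
begin

section \<open>Kronecker products and vectorization\<close>

definition kron :: "'a::field mat \<Rightarrow> 'a mat \<Rightarrow> 'a mat" where
  "kron A B = mat (dim_row A * dim_row B) (dim_col A * dim_col B)
     (\<lambda>(i, j). A $$ (i div dim_row B, j div dim_col B) * B $$ (i mod dim_row B, j mod dim_col B))"

definition kron_list :: "'a::field mat list \<Rightarrow> 'a mat" where
  "kron_list As = foldr kron As (1\<^sub>m 1)"

definition kron_power :: "nat \<Rightarrow> 'a::field mat \<Rightarrow> 'a mat" where
  "kron_power k A = kron_list (replicate k A)"

text \<open>Column stacking; the result is a matrix with a single column.\<close>

definition vec_mat :: "'a::field mat \<Rightarrow> 'a mat" where
  "vec_mat A = mat (dim_row A * dim_col A) 1 (\<lambda>(i, _). A $$ (i mod dim_row A, i div dim_row A))"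

section \<open>Linear extension from Kronecker products\<close>

definition mat_linear :: "nat \<Rightarrow> nat \<Rightarrow> nat \<Rightarrow> nat \<Rightarrow> ('a::field mat \<Rightarrow> 'a mat) \<Rightarrow> bool" where
  "mat_linear p q r s L \<longleftrightarrow>
     L \<in> carrier_mat p q \<rightarrow> carrier_mat r s \<and>
     (\<forall>X\<in>carrier_mat p q. \<forall>Y\<in>carrier_mat p q. L (X + Y) = L X + L Y) \<and>
     (\<forall>c. \<forall>X\<in>carrier_mat p q. L (c \<cdot>\<^sub>m X) = c \<cdot>\<^sub>m L X)"

definition extends_kron ::
  "nat \<Rightarrow> nat \<Rightarrow> nat \<Rightarrow> nat \<Rightarrow> nat \<Rightarrow> ('a::field mat list \<Rightarrow> 'a mat) \<Rightarrow> ('a mat \<Rightarrow> 'a mat) \<Rightarrow> bool" where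
  "extends_kron m n k r s f L \<longleftrightarrow>
     mat_linear (m ^ k) (n ^ k) r s L \<and>
     (\<forall>As. length As = k \<and> set As \<subseteq> carrier_mat m n \<longrightarrow> L (kron_list As) = f As)"

text \<open>The linear map on \<open>m\<^sup>k \<times> n\<^sup>k\<close> matrices with values in \<open>r \<times> s\<close> matrices which sends
  \<open>A\<^sub>1 \<otimes> \<dots> \<otimes> A\<^sub>k\<close> to \<open>f [A\<^sub>1, \<dots>, A\<^sub>k]\<close>. Restricting to functions that are
  \<^const>\<open>undefined\<close> off the carrier makes such a map unique. Existence depends on \<open>f\<close>; it is
  established for both uses below in \<open>rearr_extends\<close> and \<open>rearr_sum_extends\<close>.\<close>

definition kron_extension ::
  "nat \<Rightarrow> nat \<Rightarrow> nat \<Rightarrow> nat \<Rightarrow> nat \<Rightarrow> ('a::field mat list \<Rightarrow> 'a mat) \<Rightarrow> 'a mat \<Rightarrow> 'a mat" where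
  "kron_extension m n k r s f =
     (THE L. L \<in> extensional (carrier_mat (m ^ k) (n ^ k)) \<and> extends_kron m n k r s f L)"

section \<open>The rearrangement operators\<close>

text \<open>The index \<open>j\<close> ranges over \<open>{1..k}\<close>, while list positions start at 0.\<close>

definition rearr :: "nat \<Rightarrow> nat \<Rightarrow> nat \<Rightarrow> nat \<Rightarrow> 'a::field mat \<Rightarrow> 'a mat" where
  "rearr m n k j = kron_extension m n k (m * n) ((m * n) ^ (k - 1))
     (\<lambda>As. vec_mat (As ! (j - 1)) * (vec_mat (kron_list (take (j - 1) As @ drop j As)))\<^sup>T)"

definition rearr_sum :: "nat \<Rightarrow> nat \<Rightarrow> nat \<Rightarrow> 'a::field mat \<Rightarrow> 'a mat" where
  "rearr_sum m n k = kron_extension m n k (m * n) ((m * n) ^ (k - 1))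
     (\<lambda>As. mat (m * n) ((m * n) ^ (k - 1)) (\<lambda>e. \<Sum>j = 1..k. rearr m n k j (kron_list As) $$ e))"

section \<open>Well-definedness of the operators\<close>

lemma kron_carrier:
  assumes "A \<in> carrier_mat p q" "B \<in> carrier_mat r s"
  shows "kron A B \<in> carrier_mat (p * r) (q * s)"
  using assms unfolding kron_def by auto

lemma kron_index:
  assumes "A \<in> carrier_mat p q" "B \<in> carrier_mat r s" "i < p * r" "j < q * s"
  shows "kron A B $$ (i, j) = A $$ (i div r, j div s) * B $$ (i mod r, j mod s)"
  using assms unfolding kron_def by auto

lemma kron_one_left: "kron (1\<^sub>m 1) A = A"
  by (rule eq_matI) (auto simp: kron_def)

lemma div_less_prod: "(i::nat) < a * b \<Longrightarrow> i div b < a"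
  by (simp add: less_mult_imp_div_less)

lemma mod_less_prod: "(i::nat) < a * b \<Longrightarrow> i mod b < b"
  by (cases b) auto

lemma kron_assoc:
  assumes A: "A \<in> carrier_mat p q" and B: "B \<in> carrier_mat r s" and C: "C \<in> carrier_mat t u"
  shows "kron (kron A B) C = kron A (kron B C)"
proof (rule eq_matI)
  have AB: "kron A B \<in> carrier_mat (p * r) (q * s)" and BC: "kron B C \<in> carrier_mat (r * t) (s * u)"
    using assms by (auto intro: kron_carrier)
  have l: "kron (kron A B) C \<in> carrier_mat (p * r * t) (q * s * u)"
    and r: "kron A (kron B C) \<in> carrier_mat (p * (r * t)) (q * (s * u))"
    using A C AB BC kron_carrier by blast+
  show "dim_row (kron (kron A B) C) = dim_row (kron A (kron B C))"
    "dim_col (kron (kron A B) C) = dim_col (kron A (kron B C))"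
    using l r by auto
  fix i j
  assume "i < dim_row (kron A (kron B C))" "j < dim_col (kron A (kron B C))"
  then have i: "i < p * (r * t)" and j: "j < q * (s * u)" using r by auto
  have i': "i < p * r * t" and j': "j < q * s * u" using i j by (auto simp: mult.assoc)
  have "kron (kron A B) C $$ (i, j) =
      A $$ (i div t div r, j div u div s) * B $$ (i div t mod r, j div u mod s) * C $$ (i mod t, j mod u)"
    using i' j' by (simp add: kron_index[OF AB C] kron_index[OF A B] div_less_prod)
  moreover have "kron A (kron B C) $$ (i, j) = A $$ (i div (r * t), j div (s * u)) *
      (B $$ (i mod (r * t) div t, j mod (s * u) div u) * C $$ (i mod (r * t) mod t, j mod (s * u) mod u))"
    using i j by (simp add: kron_index[OF A BC] kron_index[OF B C] mod_less_prod[OF i] mod_less_prod[OF j])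
  moreover have "x div (a * b) = x div b div a" "x mod (a * b) div b = x div b mod a"
    "x mod (a * b) mod b = x mod b" for x a b :: nat
  proof -
    show "x div (a * b) = x div b div a" by (metis div_mult2_eq mult.commute)
    have re: "x mod (a * b) = b * (x div b mod a) + x mod b" by (metis mod_mult2_eq mult.commute)
    show "x mod (a * b) div b = x div b mod a" unfolding re by (cases "b = 0") simp_all
    show "x mod (a * b) mod b = x mod b" unfolding re by simp
  qed
  ultimately show "kron (kron A B) C $$ (i, j) = kron A (kron B C) $$ (i, j)"
    by (simp add: mult.assoc)
qed

lemma kron_list_carrier:
  assumes "set As \<subseteq> carrier_mat m n" "length As = k"
  shows "kron_list As \<in> carrier_mat (m ^ k) (n ^ k)"
  using assms by (induction As arbitrary: k) (auto simp: kron_list_def intro!: kron_carrier)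

lemma kron_list_append:
  assumes "set As \<subseteq> carrier_mat m n" "set Bs \<subseteq> carrier_mat m n"
  shows "kron_list (As @ Bs) = kron (kron_list As) (kron_list Bs)"
  using assms(1)
proof (induction As)
  case Nil
  show ?case by (simp add: kron_list_def kron_one_left[simplified])
next
  case (Cons A As)
  have "kron_list ((A # As) @ Bs) = kron A (kron (kron_list As) (kron_list Bs))"
    using Cons by (simp add: kron_list_def)
  also have "\<dots> = kron (kron A (kron_list As)) (kron_list Bs)"
    by (rule kron_assoc[symmetric])
      (use Cons.prems assms(2) kron_list_carrier in auto)
  finally show ?case by (simp add: kron_list_def)
qed

lemma mat_linearD:
  assumes "mat_linear p q r s L"
  shows "X \<in> carrier_mat p q \<Longrightarrow> L X \<in> carrier_mat r s"
    and "X \<in> carrier_mat p q \<Longrightarrow> Y \<in> carrier_mat p q \<Longrightarrow> L (X + Y) = L X + L Y"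
    and "X \<in> carrier_mat p q \<Longrightarrow> L (c \<cdot>\<^sub>m X) = c \<cdot>\<^sub>m L X"
  using assms unfolding mat_linear_def by (blast dest: PiE)+

lemma zero_smult_mat:
  fixes X :: "'a::field mat"
  shows "X \<in> carrier_mat a b \<Longrightarrow> 0 \<cdot>\<^sub>m X = 0\<^sub>m a b"
  by (intro eq_matI) auto

lemma mat_linear_zero:
  assumes L: "mat_linear p q r s L"
  shows "L (0\<^sub>m p q) = 0\<^sub>m r s"
  using mat_linearD(3)[OF L, of "0\<^sub>m p q" 0] zero_smult_mat[OF zero_carrier_mat, of p q]
    zero_smult_mat[OF mat_linearD(1)[OF L zero_carrier_mat]] by simp

definition unit_mat :: "nat \<Rightarrow> nat \<Rightarrow> nat \<Rightarrow> nat \<Rightarrow> 'a::field mat" where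
  "unit_mat p q a b = mat p q (\<lambda>(i, j). if i = a \<and> j = b then 1 else 0)"

lemma unit_mat_kron_list:
  assumes "a < m ^ k" "b < n ^ k"
  shows "\<exists>As. length As = k \<and> set As \<subseteq> carrier_mat m n \<and>
           kron_list As = (unit_mat (m ^ k) (n ^ k) a b :: 'a::field mat)"
  using assms
proof (induction k arbitrary: a b)
  case 0
  have "kron_list [] = (unit_mat (m ^ 0) (n ^ 0) a b :: 'a mat)"
    using 0 by (intro eq_matI) (auto simp: kron_list_def unit_mat_def)
  then show ?case by (intro exI[of _ "[]"]) simp
next
  case (Suc k)
  have "a mod m ^ k < m ^ k" "b mod n ^ k < n ^ k"
    using Suc.prems mod_less_prod by auto
  from Suc.IH[OF this] obtain As :: "'a mat list" where As: "length As = k" "set As \<subseteq> carrier_mat m n"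
    "kron_list As = unit_mat (m ^ k) (n ^ k) (a mod m ^ k) (b mod n ^ k)" by blast
  define E :: "'a mat" where "E = unit_mat m n (a div m ^ k) (b div n ^ k)"
  have E: "E \<in> carrier_mat m n" by (simp add: E_def unit_mat_def)
  have eq: "x = y \<longleftrightarrow> x div d = y div d \<and> x mod d = y mod d" for x y d :: nat
    by (metis div_mult_mod_eq)
  have "kron E (kron_list As) = unit_mat (m ^ Suc k) (n ^ Suc k) a b"
  proof (rule eq_matI)
    fix i j
    assume "i < dim_row (unit_mat (m ^ Suc k) (n ^ Suc k) a b :: 'a mat)"
      "j < dim_col (unit_mat (m ^ Suc k) (n ^ Suc k) a b :: 'a mat)"
    then have ij: "i < m * m ^ k" "j < n * n ^ k" by (auto simp: unit_mat_def)
    show "kron E (kron_list As) $$ (i, j) = unit_mat (m ^ Suc k) (n ^ Suc k) a b $$ (i, j)"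
    proof -
      have "kron E (kron_list As) $$ (i, j) =
          E $$ (i div m ^ k, j div n ^ k) * kron_list As $$ (i mod m ^ k, j mod n ^ k)"
        by (rule kron_index[OF E kron_list_carrier[OF As(2,1)] ij])
      also have "\<dots> = (if i = a \<and> j = b then 1 else 0)"
        using div_less_prod[OF ij(1)] div_less_prod[OF ij(2)] mod_less_prod[OF ij(1)] mod_less_prod[OF ij(2)]
        unfolding As(3) E_def eq[of i a "m ^ k"] eq[of j b "n ^ k"] by (simp add: unit_mat_def)
      finally show ?thesis using ij by (simp add: unit_mat_def)
    qed
  qed (use E As(3) in \<open>auto simp: kron_def unit_mat_def\<close>)
  then show ?case
    using As E by (intro exI[of _ "E # As"]) (auto simp: kron_list_def)
qed

lemma mat_linear_eqI:
  assumes L: "mat_linear p q r s L" and L': "mat_linear p q r s L'"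
    and unit: "\<And>a b. a < p \<Longrightarrow> b < q \<Longrightarrow> L (unit_mat p q a b) = L' (unit_mat p q a b)"
    and M: "M \<in> carrier_mat p q"
  shows "L M = L' M"
proof -
  define N where "N S = mat p q (\<lambda>e. if e \<in> S then M $$ e else 0)" for S
  have "L (N S) = L' (N S)" if "finite S" "S \<subseteq> {..<p} \<times> {..<q}" for S
    using that
  proof (induction S rule: finite_induct)
    case empty
    have "N {} = 0\<^sub>m p q" by (intro eq_matI) (auto simp: N_def)
    then show ?case using mat_linear_zero[OF L] mat_linear_zero[OF L'] by simp
  next
    case (insert e S)
    obtain a b where e: "e = (a, b)" "a < p" "b < q" using insert.prems by (cases e) auto
    have split: "N (insert e S) = M $$ (a, b) \<cdot>\<^sub>m unit_mat p q a b + N S"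
      using insert.hyps e by (intro eq_matI) (auto simp: N_def unit_mat_def)
    have c: "unit_mat p q a b \<in> carrier_mat p q" "M $$ (a, b) \<cdot>\<^sub>m unit_mat p q a b \<in> carrier_mat p q"
      "N S \<in> carrier_mat p q" by (auto simp: N_def unit_mat_def)
    have "L (N S) = L' (N S)" using insert by auto
    then show ?case
      unfolding split by (simp only: mat_linearD(2)[OF L c(2,3)] mat_linearD(2)[OF L' c(2,3)]
        mat_linearD(3)[OF L c(1)] mat_linearD(3)[OF L' c(1)] unit[OF e(2,3)])
  qed
  from this[of "{..<p} \<times> {..<q}"] have "L (N ({..<p} \<times> {..<q})) = L' (N ({..<p} \<times> {..<q}))" by simp
  moreover have "N ({..<p} \<times> {..<q}) = M" using M by (intro eq_matI) (auto simp: N_def)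
  ultimately show ?thesis by simp
qed

lemma kron_extension_unique:
  fixes L L' :: "'a::field mat \<Rightarrow> 'a mat"
  assumes "extends_kron m n k r s f L" "extends_kron m n k r s f L'" "M \<in> carrier_mat (m ^ k) (n ^ k)"
  shows "L M = L' M"
proof (rule mat_linear_eqI[OF _ _ _ assms(3)])
  show "mat_linear (m ^ k) (n ^ k) r s L" "mat_linear (m ^ k) (n ^ k) r s L'"
    using assms by (auto simp: extends_kron_def)
  show "L (unit_mat (m ^ k) (n ^ k) a b) = L' (unit_mat (m ^ k) (n ^ k) a b)"
    if ab: "a < m ^ k" "b < n ^ k" for a b
  proof -
    obtain As :: "'a mat list" where "length As = k" "set As \<subseteq> carrier_mat m n"
      "kron_list As = unit_mat (m ^ k) (n ^ k) a b"
      using unit_mat_kron_list[OF ab] by blast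
    then show ?thesis using assms(1,2) unfolding extends_kron_def by metis
  qed
qed

lemma extends_kron_cong:
  fixes L L' :: "'a::field mat \<Rightarrow> 'a mat"
  assumes L: "extends_kron m n k r s f L"
    and eq: "\<And>M. M \<in> carrier_mat (m ^ k) (n ^ k) \<Longrightarrow> L' M = L M"
  shows "extends_kron m n k r s f L'"
proof -
  have lin: "mat_linear (m ^ k) (n ^ k) r s L" using L by (simp add: extends_kron_def)
  have "mat_linear (m ^ k) (n ^ k) r s L'"
    unfolding mat_linear_def
    by (intro conjI ballI allI Pi_I) (simp_all add: eq mat_linearD[OF lin])
  moreover have "L' (kron_list As) = f As" if "length As = k" "set As \<subseteq> carrier_mat m n" for As
    using that L eq[OF kron_list_carrier] by (simp add: extends_kron_def)
  ultimately show ?thesis by (simp add: extends_kron_def)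
qed

lemma extends_kron_extension:
  assumes L: "extends_kron m n k r s f L"
  shows "extends_kron m n k r s f (kron_extension m n k r s f)"
proof -
  let ?C = "carrier_mat (m ^ k) (n ^ k)"
  have "\<exists>!L. L \<in> extensional ?C \<and> extends_kron m n k r s f L"
  proof (rule ex1I[of _ "restrict L ?C"])
    show "restrict L ?C \<in> extensional ?C \<and> extends_kron m n k r s f (restrict L ?C)"
      using extends_kron_cong[OF L, of "restrict L ?C"] by simp
    fix L' assume "L' \<in> extensional ?C \<and> extends_kron m n k r s f L'"
    then show "L' = restrict L ?C"
      using kron_extension_unique[OF L, of L'] by (auto intro!: extensionalityI[of _ ?C])
  qed
  from theI'[OF this] show ?thesis unfolding kron_extension_def by blast
qed

text \<open>Entrywise, the \<open>j\<close>-th operator inserts a base-\<open>m\<close> digit into the row index and a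
  base-\<open>n\<close> digit into the column index, both at the position of the \<open>j\<close>-th factor.\<close>

lemma kron_list_insert_index:
  assumes X: "X \<in> carrier_mat p q" and A: "A \<in> carrier_mat m n" and Y: "Y \<in> carrier_mat h l"
    and i: "i < p * h" "a < m" and j: "j < q * l" "b < n"
  shows "kron X (kron A Y) $$ ((i div h * m + a) * h + i mod h, (j div l * n + b) * l + j mod l) =
    A $$ (a, b) * kron X Y $$ (i, j)"
proof -
  have AY: "kron A Y \<in> carrier_mat (m * h) (n * l)" using A Y by (rule kron_carrier)
  have *: "((x div d * e + c) * d + x mod d) div (e * d) = x div d"
    "((x div d * e + c) * d + x mod d) mod (e * d) = c * d + x mod d"
    "(c * d + x mod d) div d = c" "(c * d + x mod d) mod d = x mod d"
    "c * d + x mod d < e * d"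
    "(x div d * e + c) * d + x mod d < w * (e * d)"
    if "x < w * d" "c < e" for x d e c w :: nat
  proof -
    have d: "d > 0" using that by (cases d) auto
    have lt: "c * d + x mod d < e * d"
    proof -
      have "c * d + x mod d < c * d + d" using d by simp
      also have "\<dots> = Suc c * d" by simp
      also have "\<dots> \<le> e * d" using that by (intro mult_right_mono) auto
      finally show ?thesis .
    qed
    have re: "(x div d * e + c) * d + x mod d = x div d * (e * d) + (c * d + x mod d)"
      by (simp add: algebra_simps)
    show "c * d + x mod d < e * d" by (fact lt)
    have ed: "e * d \<noteq> 0" using lt by linarith
    show "((x div d * e + c) * d + x mod d) div (e * d) = x div d"
      unfolding re using div_mult_self3[OF ed, of "x div d" "c * d + x mod d"] div_less[OF lt] by linarith
    show "((x div d * e + c) * d + x mod d) mod (e * d) = c * d + x mod d"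
      unfolding re using mod_mult_self3[of "x div d" "e * d" "c * d + x mod d"] mod_less[OF lt] by linarith
    show "(c * d + x mod d) div d = c" "(c * d + x mod d) mod d = x mod d" using d by auto
    have "x div d * (e * d) + (c * d + x mod d) < x div d * (e * d) + e * d" using lt by simp
    also have "\<dots> = Suc (x div d) * (e * d)" by simp
    also have "\<dots> \<le> w * (e * d)" using div_less_prod[OF that(1)] by (intro mult_right_mono) auto
    finally show "(x div d * e + c) * d + x mod d < w * (e * d)" unfolding re .
  qed
  note * = *[OF i] *[OF j]
  show ?thesis
    using * i j by (simp add: kron_index[OF X AY] kron_index[OF A Y] kron_index[OF X Y] mult.left_commute)
qed

lemma outer_index:
  assumes A: "A \<in> carrier_mat m n" and B: "B \<in> carrier_mat p q"
  shows "vec_mat A * (vec_mat B)\<^sup>T \<in> carrier_mat (m * n) (p * q)"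
    and "a < m * n \<Longrightarrow> b < p * q \<Longrightarrow> (vec_mat A * (vec_mat B)\<^sup>T) $$ (a, b) =
      A $$ (a mod m, a div m) * B $$ (b mod p, b div p)"
  using assms by (auto simp: vec_mat_def scalar_prod_def)

lemma rearr_extends:
  fixes m n k j :: nat
  assumes j: "j \<in> {1..k}"
  shows "extends_kron m n k (m * n) ((m * n) ^ (k - 1))
    (\<lambda>As. vec_mat (As ! (j - 1)) * (vec_mat (kron_list (take (j - 1) As @ drop j As)))\<^sup>T)
    (rearr m n k j :: 'a::field mat \<Rightarrow> 'a mat)"
proof -
  let ?p = "m ^ (k - 1)" and ?q = "n ^ (k - 1)"
  let ?h = "m ^ (k - j)" and ?l = "n ^ (k - j)"
  define row where "row a b = ((b mod ?p) div ?h * m + a mod m) * ?h + (b mod ?p) mod ?h" for a b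
  define col where "col a b = ((b div ?p) div ?l * n + a div m) * ?l + (b div ?p) mod ?l" for a b
  define L :: "'a mat \<Rightarrow> 'a mat" where
    "L M = mat (m * n) ((m * n) ^ (k - 1)) (\<lambda>(a, b). M $$ (row a b, col a b))" for M
  have pk: "m ^ (j - 1) * ?h = ?p" "n ^ (j - 1) * ?l = ?q"
    using j by (auto simp flip: power_add)
  have pk': "x ^ (j - 1) * (x * x ^ (k - j)) = x ^ k" for x :: nat
  proof -
    have "j - 1 + Suc (k - j) = k" using j by auto
    then have "x ^ (j - 1) * x ^ Suc (k - j) = x ^ k" by (metis power_add)
    then show ?thesis by simp
  qed
  have pos: "row a b < m ^ k" "col a b < n ^ k"
    if ab: "a < m * n" "b < (m * n) ^ (k - 1)" for a b
  proof -
    have b: "b < ?p * ?q" using ab by (simp add: power_mult_distrib)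
    have bound: "(x div d * e + c) * d + x mod d < w * (e * d)" if "x < w * d" "c < e" for x d e c w :: nat
    proof -
      have d: "d > 0" using that by (cases d) auto
      have "(x div d * e + c) * d + x mod d < (x div d * e + c) * d + d" using d by simp
      also have "\<dots> = (x div d * e + Suc c) * d" by simp
      also have "\<dots> \<le> (x div d * e + e) * d" using that by (intro mult_right_mono add_left_mono) auto
      also have "\<dots> = Suc (x div d) * (e * d)" by (simp add: algebra_simps)
      also have "\<dots> \<le> w * (e * d)" using div_less_prod[OF that(1)] by (intro mult_right_mono) auto
      finally show ?thesis .
    qed
    have 1: "b mod ?p < m ^ (j - 1) * ?h" "b div ?p < n ^ (j - 1) * ?l"
      using mod_less_prod[of b ?q ?p] div_less_prod[of b ?q ?p] b unfolding pk by (auto simp: mult.commute)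
    have 2: "a mod m < m" "a div m < n"
      using mod_less_prod[of a n m] div_less_prod[of a n m] ab by (auto simp: mult.commute)
    show "row a b < m ^ k" "col a b < n ^ k"
      using bound[OF 1(1) 2(1)] bound[OF 1(2) 2(2)] unfolding pk' row_def col_def by auto
  qed
  have ix: "L M $$ (a, b) = M $$ (row a b, col a b)"
    if "a < m * n" "b < (m * n) ^ (k - 1)" for a b M
    using that by (simp add: L_def)
  have dims: "dim_row (L M) = m * n" "dim_col (L M) = (m * n) ^ (k - 1)" for M
    by (simp_all add: L_def)
  have lin: "mat_linear (m ^ k) (n ^ k) (m * n) ((m * n) ^ (k - 1)) L"
    unfolding mat_linear_def
  proof (intro conjI ballI allI)
    show "L \<in> carrier_mat (m ^ k) (n ^ k) \<rightarrow> carrier_mat (m * n) ((m * n) ^ (k - 1))"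
      by (simp add: L_def)
    fix X :: "'a mat" assume X: "X \<in> carrier_mat (m ^ k) (n ^ k)"
    show "L (c \<cdot>\<^sub>m X) = c \<cdot>\<^sub>m L X" for c
      using X ix[of _ _ "c \<cdot>\<^sub>m X"] ix[of _ _ X] pos by (intro eq_matI) (auto simp: dims)
    fix Y :: "'a mat" assume Y: "Y \<in> carrier_mat (m ^ k) (n ^ k)"
    show "L (X + Y) = L X + L Y"
      using X Y ix[of _ _ "X + Y"] ix[of _ _ X] ix[of _ _ Y] pos
      by (intro eq_matI) (auto simp: dims)
  qed
  have val: "L (kron_list As) =
      vec_mat (As ! (j - 1)) * (vec_mat (kron_list (take (j - 1) As @ drop j As)))\<^sup>T"
    if As: "length As = k" "set As \<subseteq> carrier_mat m n" for As
  proof -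
    let ?A = "As ! (j - 1)" and ?X = "kron_list (take (j - 1) As)" and ?Y = "kron_list (drop j As)"
    have sub: "set (take (j - 1) As) \<subseteq> carrier_mat m n" "set (drop j As) \<subseteq> carrier_mat m n"
      using As set_take_subset set_drop_subset by fastforce+
    have A: "?A \<in> carrier_mat m n" using As j by auto
    have X: "?X \<in> carrier_mat (m ^ (j - 1)) (n ^ (j - 1))" and Y: "?Y \<in> carrier_mat ?h ?l"
      using sub As j by (auto intro!: kron_list_carrier)
    have "As = take (j - 1) As @ ?A # drop j As"
      using id_take_nth_drop[of "j - 1" As] As j by auto
    then have "kron_list As = kron ?X (kron_list (?A # drop j As))"
      using kron_list_append[of "take (j - 1) As" m n "?A # drop j As"] sub A by simp
    then have 1: "kron_list As = kron ?X (kron ?A ?Y)" by (simp add: kron_list_def)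
    have 2: "kron_list (take (j - 1) As @ drop j As) = kron ?X ?Y"
      using kron_list_append sub by blast
    have XY: "kron ?X ?Y \<in> carrier_mat ?p ?q" using kron_carrier[OF X Y] unfolding pk .
    show ?thesis
    proof (rule eq_matI)
      show "dim_row (L (kron_list As)) =
          dim_row (vec_mat ?A * (vec_mat (kron_list (take (j - 1) As @ drop j As)))\<^sup>T)"
        "dim_col (L (kron_list As)) =
          dim_col (vec_mat ?A * (vec_mat (kron_list (take (j - 1) As @ drop j As)))\<^sup>T)"
        using outer_index(1)[OF A XY] unfolding 2 by (auto simp: L_def power_mult_distrib)
      fix a b
      assume "a < dim_row (vec_mat ?A * (vec_mat (kron_list (take (j - 1) As @ drop j As)))\<^sup>T)"
        "b < dim_col (vec_mat ?A * (vec_mat (kron_list (take (j - 1) As @ drop j As)))\<^sup>T)"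
      then have a: "a < m * n" and b: "b < ?p * ?q" using outer_index(1)[OF A XY] unfolding 2 by auto
      have i1: "b mod ?p < m ^ (j - 1) * ?h" "b div ?p < n ^ (j - 1) * ?l"
        using mod_less_prod[of b ?q ?p] div_less_prod[of b ?q ?p] b unfolding pk by (auto simp: mult.commute)
      have i2: "a mod m < m" "a div m < n"
        using mod_less_prod[of a n m] div_less_prod[of a n m] a by (auto simp: mult.commute)
      have "L (kron_list As) $$ (a, b) = kron ?X (kron ?A ?Y) $$ (row a b, col a b)"
        unfolding L_def 1 using a b by (simp add: power_mult_distrib)
      also have "\<dots> = ?A $$ (a mod m, a div m) * kron ?X ?Y $$ (b mod ?p, b div ?p)"
        unfolding row_def col_def by (rule kron_list_insert_index[OF X A Y i1(1) i2(1) i1(2) i2(2)])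
      also have "\<dots> = (vec_mat ?A * (vec_mat (kron ?X ?Y))\<^sup>T) $$ (a, b)"
        using outer_index(2)[OF A XY a b] by simp
      finally show "L (kron_list As) $$ (a, b) =
          (vec_mat ?A * (vec_mat (kron_list (take (j - 1) As @ drop j As)))\<^sup>T) $$ (a, b)"
        unfolding 2 .
    qed
  qed
  show ?thesis
    unfolding rearr_def by (rule extends_kron_extension[of _ _ _ _ _ _ L]) (use lin val in \<open>simp add: extends_kron_def\<close>)
qed

lemma rearr_sum_extends:
  fixes m n k :: nat
  shows "extends_kron m n k (m * n) ((m * n) ^ (k - 1))
    (\<lambda>As. mat (m * n) ((m * n) ^ (k - 1)) (\<lambda>e. \<Sum>j = 1..k. rearr m n k j (kron_list As) $$ e))
    (rearr_sum m n k :: 'a::field mat \<Rightarrow> 'a mat)"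
proof -
  define L :: "'a mat \<Rightarrow> 'a mat" where
    "L M = mat (m * n) ((m * n) ^ (k - 1)) (\<lambda>e. \<Sum>j = 1..k. rearr m n k j M $$ e)" for M
  have lin: "mat_linear (m ^ k) (n ^ k) (m * n) ((m * n) ^ (k - 1)) (rearr m n k j :: 'a mat \<Rightarrow> 'a mat)"
    if "j \<in> {1..k}" for j
    using rearr_extends[OF that] by (auto simp: extends_kron_def)
  have "mat_linear (m ^ k) (n ^ k) (m * n) ((m * n) ^ (k - 1)) L"
    unfolding mat_linear_def
  proof (intro conjI ballI allI)
    show "L \<in> carrier_mat (m ^ k) (n ^ k) \<rightarrow> carrier_mat (m * n) ((m * n) ^ (k - 1))"
      by (simp add: L_def)
    fix X :: "'a mat" assume X: "X \<in> carrier_mat (m ^ k) (n ^ k)"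
    have c: "rearr m n k j Z \<in> carrier_mat (m * n) ((m * n) ^ (k - 1))"
      if "j \<in> {1..k}" "Z \<in> carrier_mat (m ^ k) (n ^ k)" for j and Z :: "'a mat"
      using lin[OF that(1)] that(2) by (auto simp: mat_linear_def)
    show "L (c \<cdot>\<^sub>m X) = c \<cdot>\<^sub>m L X" for c
    proof -
      have "rearr m n k j (c \<cdot>\<^sub>m X) $$ e = c * rearr m n k j X $$ e"
        if "j \<in> {1..k}" "e \<in> {..<m * n} \<times> {..<(m * n) ^ (k - 1)}" for j e
        using lin[OF that(1)] c[OF that(1) X] X that(2) by (auto simp: mat_linear_def)
      then show ?thesis
        by (intro eq_matI) (auto simp: L_def sum_distrib_left intro!: sum.cong)
    qed
    fix Y :: "'a mat" assume Y: "Y \<in> carrier_mat (m ^ k) (n ^ k)"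
    have "rearr m n k j (X + Y) $$ e = rearr m n k j X $$ e + rearr m n k j Y $$ e"
      if "j \<in> {1..k}" "e \<in> {..<m * n} \<times> {..<(m * n) ^ (k - 1)}" for j e
      using lin[OF that(1)] c[OF that(1) X] c[OF that(1) Y] X Y that(2) by (auto simp: mat_linear_def)
    then have "(\<Sum>j = 1..k. rearr m n k j (X + Y) $$ e) =
        (\<Sum>j = 1..k. rearr m n k j X $$ e) + (\<Sum>j = 1..k. rearr m n k j Y $$ e)"
      if "e \<in> {..<m * n} \<times> {..<(m * n) ^ (k - 1)}" for e
      using that unfolding sum.distrib[symmetric] by (intro sum.cong) auto
    then show "L (X + Y) = L X + L Y"
      by (intro eq_matI) (auto simp: L_def)
  qed
  then show ?thesis
    unfolding rearr_sum_def
    by (intro extends_kron_extension[of _ _ _ _ _ _ L]) (simp add: extends_kron_def L_def)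
qed

end

theory Submission
  imports Defs
begin

text \<open>Removing any one factor from \<open>A \<otimes> \<dots> \<otimes> A\<close> leaves the same matrix \<open>B\<close>, the power with one
  factor fewer. So all \<open>k\<close> rearrangements of \<open>M\<close> coincide with the outer product
  \<open>vec(A) vec(B)\<^sup>T\<close>, and their sum is \<open>k\<close> times this product (\<open>rearr_sum_kron_power\<close>).
  A multiple of an outer product has rank at most one, and the rank can drop to zero only if the
  multiple vanishes. It does not: \<open>A\<close> and \<open>B\<close> are non-zero because \<open>M = A \<otimes> B\<close> is, and the
  scalar \<open>k\<close> is non-zero in \<open>F\<close> by the hypothesis on the characteristic.\<close>

lemma kron_power_carrier:
  assumes "A \<in> carrier_mat m n"
  shows "kron_power k A \<in> carrier_mat (m ^ k) (n ^ k)"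
  unfolding kron_power_def using assms by (intro kron_list_carrier) auto

lemma kron_power_Suc: "kron_power (Suc k) A = kron A (kron_power k A)"
  by (simp add: kron_power_def kron_list_def)

lemma kron_nonzeroD:
  assumes A: "A \<in> carrier_mat p q" and B: "B \<in> carrier_mat r s"
    and nz: "kron A B \<noteq> 0\<^sub>m (p * r) (q * s)"
  shows "A \<noteq> 0\<^sub>m p q" and "B \<noteq> 0\<^sub>m r s"
proof -
  have "kron A B = 0\<^sub>m (p * r) (q * s)" if "A = 0\<^sub>m p q \<or> B = 0\<^sub>m r s"
  proof (rule eq_matI)
    fix i j
    assume "i < dim_row (0\<^sub>m (p * r) (q * s) :: 'a mat)" "j < dim_col (0\<^sub>m (p * r) (q * s) :: 'a mat)"
    then have ij: "i < p * r" "j < q * s" by auto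
    show "kron A B $$ (i, j) = 0\<^sub>m (p * r) (q * s) $$ (i, j)"
      using that div_less_prod[OF ij(1)] div_less_prod[OF ij(2)]
        mod_less_prod[OF ij(1)] mod_less_prod[OF ij(2)] ij
      by (auto simp: kron_index[OF A B ij])
  qed (use kron_carrier[OF A B] in auto)
  with nz show "A \<noteq> 0\<^sub>m p q" "B \<noteq> 0\<^sub>m r s" by auto
qed

lemma nonzero_entry:
  assumes "A \<in> carrier_mat p q" "A \<noteq> 0\<^sub>m p q"
  obtains i j where "i < p" "j < q" "A $$ (i, j) \<noteq> 0"
proof -
  have "\<exists>i<p. \<exists>j<q. A $$ (i, j) \<noteq> 0"
  proof (rule ccontr)
    assume "\<not> ?thesis"
    then have "A = 0\<^sub>m p q" using assms(1) by (intro eq_matI) auto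
    with assms(2) show False by simp
  qed
  then show thesis using that by blast
qed

lemma outer_nonzero:
  fixes A B :: "'a::field mat"
  assumes A: "A \<in> carrier_mat m n" "A \<noteq> 0\<^sub>m m n" and B: "B \<in> carrier_mat p q" "B \<noteq> 0\<^sub>m p q"
  shows "vec_mat A * (vec_mat B)\<^sup>T \<noteq> 0\<^sub>m (m * n) (p * q)"
proof -
  obtain i j where ij: "i < m" "j < n" "A $$ (i, j) \<noteq> 0" using nonzero_entry[OF A] .
  obtain r s where rs: "r < p" "s < q" "B $$ (r, s) \<noteq> 0" using nonzero_entry[OF B] .
  have pos: "x + y * b < b * d" if "x < b" "y < d" for x y b d :: nat
  proof -
    have "x + y * b < b * Suc y" using that by simp
    also have "\<dots> \<le> b * d" using that by (intro mult_le_mono2) simp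
    finally show ?thesis .
  qed
  \<comment> \<open>Column stacking puts the entry at \<open>(i, j)\<close> at position \<open>i + j * m\<close>.\<close>
  have a: "i + j * m < m * n" and b: "r + s * p < p * q"
    using pos ij rs by auto
  have "(vec_mat A * (vec_mat B)\<^sup>T) $$ (i + j * m, r + s * p) = A $$ (i, j) * B $$ (r, s)"
    using outer_index(2)[OF A(1) B(1) a b] ij rs by simp
  also have "\<dots> \<noteq> 0" using ij rs by simp
  finally show ?thesis using a b by auto
qed

context vec_space
begin

text \<open>A non-zero column is by itself a linearly independent set of columns.\<close>

lemma rank_pos_of_nonzero:
  assumes A: "A \<in> carrier_mat n nc" "A \<noteq> 0\<^sub>m n nc"
  shows "1 \<le> rank A"
proof -
  obtain i j where ij: "i < n" "j < nc" "A $$ (i, j) \<noteq> 0" using nonzero_entry[OF A] .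
  define w where "w = col A j"
  have w: "w \<in> carrier_vec n" "w $ i \<noteq> 0" "w \<in> set (cols A)"
    using ij A(1) by (auto simp: w_def cols_def)
  have "lin_indpt {w}"
  proof
    assume "lin_dep {w}"
    then obtain S a v where S: "S \<subseteq> {w}" "lincomb a S = 0\<^sub>v n" "v \<in> S" "a v \<noteq> 0"
      unfolding lin_dep_def by auto
    have "S = {w}" "v = w" using S by auto
    then have "a w \<cdot>\<^sub>v w = 0\<^sub>v n" using S(2) w(1) by (simp add: lincomb_def)
    then have "(a w \<cdot>\<^sub>v w) $ i = 0" using ij(1) by simp
    then show False using w ij(1) S(4) \<open>v = w\<close> by simp
  qed
  then show ?thesis using rank_ge_card_indpt[OF A(1), of "{w}"] w(3) by simp
qed

end

lemma rearr_kron_power: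
  fixes A :: "'a::field mat"
  assumes A: "A \<in> carrier_mat m n" and j: "j \<in> {1..k}"
  shows "rearr m n k j (kron_power k A) = vec_mat A * (vec_mat (kron_power (k - 1) A))\<^sup>T"
proof -
  let ?As = "replicate k A"
  have len: "min (j - 1) k + (k - j) = k - 1" using j by auto
  have rest: "take (j - 1) ?As @ drop j ?As = replicate (k - 1) A"
    by (simp only: take_replicate drop_replicate len flip: replicate_add)
  have "rearr m n k j (kron_list ?As) =
      vec_mat (?As ! (j - 1)) * (vec_mat (kron_list (take (j - 1) ?As @ drop j ?As)))\<^sup>T"
    by (rule rearr_extends[OF j, unfolded extends_kron_def, THEN conjunct2, rule_format]) (use A in auto)
  also have "?As ! (j - 1) = A" using j by (intro nth_replicate) auto
  finally show ?thesis unfolding rest kron_power_def .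
qed

lemma rearr_sum_kron_power:
  fixes A :: "'a::field mat"
  assumes A: "A \<in> carrier_mat m n"
  shows "rearr_sum m n k (kron_power k A) =
    of_nat k \<cdot>\<^sub>m (vec_mat A * (vec_mat (kron_power (k - 1) A))\<^sup>T)"
proof -
  let ?N = "vec_mat A * (vec_mat (kron_power (k - 1) A))\<^sup>T"
  have N: "?N \<in> carrier_mat (m * n) ((m * n) ^ (k - 1))"
    using outer_index(1)[OF A kron_power_carrier[OF A]] by (simp add: power_mult_distrib)
  have "rearr_sum m n k (kron_power k A) =
      mat (m * n) ((m * n) ^ (k - 1)) (\<lambda>e. \<Sum>j = 1..k. rearr m n k j (kron_power k A) $$ e)"
    unfolding kron_power_def
    by (rule rearr_sum_extends[unfolded extends_kron_def, THEN conjunct2, rule_format]) (use A in auto)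
  also have "\<dots> = mat (m * n) ((m * n) ^ (k - 1)) (\<lambda>e. \<Sum>j = 1..k. ?N $$ e)"
    by (simp add: rearr_kron_power[OF A])
  also have "mat p q (\<lambda>e. \<Sum>j = 1..k. X $$ e) = of_nat k \<cdot>\<^sub>m X"
    if "X \<in> carrier_mat p q" for X :: "'a mat" and p q
    using that by (intro eq_matI) auto
  note this[OF N]
  finally show ?thesis .
qed

theorem theorem3:
  fixes m n k :: nat and M A :: "'a::field mat"
  assumes "0 < m" and "0 < n" and "0 < k"
    and "\<not> CHAR('a) dvd k"
    and "M \<in> carrier_mat (m ^ k) (n ^ k)" and "M \<noteq> 0\<^sub>m (m ^ k) (n ^ k)"
    and "A \<in> carrier_mat m n"
    and "M = kron_power k A"
  shows "vec_space.rank (m * n) (rearr_sum m n k M) = 1"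
proof -
  note A = assms(7)
  define B where "B = kron_power (k - 1) A"
  define N where "N = vec_mat A * (vec_mat B)\<^sup>T"
  have B: "B \<in> carrier_mat (m ^ (k - 1)) (n ^ (k - 1))"
    unfolding B_def by (rule kron_power_carrier[OF A])
  have k: "of_nat k \<noteq> (0 :: 'a)" using assms(4) by (simp add: of_nat_eq_0_iff_char_dvd)
  have R: "rearr_sum m n k M = of_nat k \<cdot>\<^sub>m N"
    unfolding assms(8) N_def B_def by (rule rearr_sum_kron_power[OF A])
  have "M = kron A B"
    using kron_power_Suc[of "k - 1" A] assms(3,8) by (simp add: B_def)
  moreover have "x ^ k = x * x ^ (k - 1)" for x :: nat
    using assms(3) by (simp add: power_eq_if)
  ultimately have "kron A B \<noteq> 0\<^sub>m (m * m ^ (k - 1)) (n * n ^ (k - 1))"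
    using assms(6) by simp
  note nz = kron_nonzeroD[OF A B this]
  let ?c = "m ^ (k - 1) * n ^ (k - 1)"
  have N: "N \<in> carrier_mat (m * n) ?c" "N \<noteq> 0\<^sub>m (m * n) ?c"
    unfolding N_def using outer_index(1)[OF A B] outer_nonzero[OF A nz(1) B nz(2)] by auto
  have kN: "of_nat k \<cdot>\<^sub>m N \<in> carrier_mat (m * n) ?c" using N(1) by simp
  obtain i j where "i < m * n" "j < ?c" "N $$ (i, j) \<noteq> 0" using nonzero_entry[OF N] .
  then have "(of_nat k \<cdot>\<^sub>m N) $$ (i, j) \<noteq> 0" using k N(1) by simp
  then have kN0: "of_nat k \<cdot>\<^sub>m N \<noteq> 0\<^sub>m (m * n) ?c"
    using \<open>i < m * n\<close> \<open>j < ?c\<close> by auto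
  have "vec_space.rank (m * n) (of_nat k \<cdot>\<^sub>m N) \<le> 1"
  proof (rule vec_space.rank_le_1_product_entries[OF kN])
    fix r c assume "r < dim_row (of_nat k \<cdot>\<^sub>m N)" "c < dim_col (of_nat k \<cdot>\<^sub>m N)"
    then have rc: "r < m * n" "c < ?c" using N(1) by auto
    have "(of_nat k \<cdot>\<^sub>m N) $$ (r, c) = of_nat k * N $$ (r, c)" using rc N(1) by simp
    also have "N $$ (r, c) = A $$ (r mod m, r div m) * B $$ (c mod m ^ (k - 1), c div m ^ (k - 1))"
      unfolding N_def by (rule outer_index(2)[OF A B rc])
    finally show "(of_nat k \<cdot>\<^sub>m N) $$ (r, c) =
        (of_nat k * A $$ (r mod m, r div m)) * B $$ (c mod m ^ (k - 1), c div m ^ (k - 1))"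
      by (simp only: mult.assoc)
  qed
  with vec_space.rank_pos_of_nonzero[OF kN kN0] show ?thesis unfolding R by simp
qed

end
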